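(* Let $\mathcal{Q}$ be a quaternion division algebra over a field $\mathbb{F}$, and let $q\in\mathcal{Q}\setminus\{0\}$. Then the diagonal matrix $\operatorname{Diag}(q,q,q)$ is not the sum of two nilpotent matrices of $\operatorname{M}_3(\mathcal{Q})$.
   Context: $\mathbb{F}$ is an arbitrary field (characteristic $2$ allowed). A quaternion division algebra over $\mathbb{F}$ is a $4$-dimensional associative unital $\mathbb{F}$-algebra with center $\mathbb{F}$ that is a division ring. $\operatorname{M}_3(\mathcal{Q})$ is the ring of $3\times 3$ matrices with entries in $\mathcal{Q}$. *)

theory Defs
  imports "Jordan_Normal_Form.Matrix"
begin

text \<open>The algebra is the whole type \<open>'q\<close>, with structure map \<open>scale\<close> over the field \<open>'f\<close>.
  Bases in the sense of \<open>dim\<close> may be infinite, but \<open>dim\<close> is \<open>0\<close> then; so \<open>dim UNIV = 4\<close> does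
  force finite dimension.\<close>

locale quaternion_division_algebra = vector_space scale
  for scale :: "'f::field \<Rightarrow> 'q::division_ring \<Rightarrow> 'q" +
  assumes mult_scale_left: "scale a x * y = scale a (x * y)"
    and mult_scale_right: "x * scale a y = scale a (x * y)"
    and dim_eq_4: "dim UNIV = 4"
    and center_eq: "{z. \<forall>x. z * x = x * z} = range (\<lambda>a. scale a 1)"

definition nilpotent_mat :: "nat \<Rightarrow> 'a::semiring_1 mat \<Rightarrow> bool" where
  "nilpotent_mat n A \<longleftrightarrow> A \<in> carrier_mat n n \<and> (\<exists>k. A ^\<^sub>m k = 0\<^sub>m n n)"

end

theory Submission
  imports Defs "HOL-Library.Product_Plus"
begin

text \<open>Suppose \<open>d = f + g\<close> is left multiplication by \<open>q\<close> on the right space \<open>Q\<^sup>3\<close>, with \<open>f\<close> and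
  \<open>g\<close> nilpotent, and let \<open>f x = 0\<close> with \<open>x \<noteq> 0\<close>, so \<open>g x = d x\<close>. If \<open>q\<close> is central, \<open>x\<close>
  is an eigenvector of \<open>g\<close>, which is absurd. Otherwise \<open>q\<^sup>2 = s q + t\<close> with \<open>s\<close>, \<open>t\<close> central,
  and the kernel of \<open>f\<close> is a line. If \<open>g (d x) = 0\<close>, then \<open>s = 0\<close> and the plane spanned
  by \<open>x\<close> and \<open>d x\<close> is stable under \<open>f\<close> and \<open>g\<close>; both act as zero on the one-dimensional
  quotient, but \<open>d\<close> is bijective. If \<open>y = g (d x) \<noteq> 0\<close>, then \<open>x\<close>, \<open>d x\<close>, \<open>y\<close> is a basis, and
  expressing \<open>f (f y) \<in> ker f\<close> and \<open>d (d y) = d y s + y t\<close> in it forces \<open>t = 2 s\<^sup>2\<close>. Then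
  \<open>q\<^sup>2 - s q - t = (q + s) (q - 2 s)\<close>, so \<open>q\<close> is central after all.\<close>

section \<open>Prerequisites over division rings: linear systems and quadratic elements\<close>

text \<open>Gaussian elimination, by induction on the equations. Coefficients stand to the left of
  the unknowns, so a nonzero pivot \<open>M e p\<close> solves equation \<open>e\<close> for the
  unknown \<open>p\<close>; substitution into the other equations leaves the system
  \<open>M'\<close> in the remaining unknowns.\<close>

lemma homogeneous_system_nontrivial_solution:
  fixes M :: "'i \<Rightarrow> 'j \<Rightarrow> 'q::division_ring"
  assumes "finite E" "finite J" "card E < card J"
  shows "\<exists>x. (\<exists>j\<in>J. x j \<noteq> 0) \<and> (\<forall>i\<in>E. (\<Sum>j\<in>J. M i j * x j) = 0)"
  using assms
proof (induction E arbitrary: J M rule: finite_induct)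
  case empty
  then obtain j where "j \<in> J" by fastforce
  then show ?case by (intro exI[of _ "\<lambda>_. 1"]) auto
next
  case (insert e E)
  show ?case
  proof (cases "\<forall>j\<in>J. M e j = 0")
    case True
    from insert.IH[of J M] insert.prems insert.hyps True show ?thesis by fastforce
  next
    case False
    then obtain p where p: "p \<in> J" "M e p \<noteq> 0" by blast
    define M' where "M' i j = M i j - M i p * inverse (M e p) * M e j" for i j
    have "card E < card (J - {p})"
      using insert.prems insert.hyps p by simp
    then obtain x where x: "\<exists>j\<in>J - {p}. x j \<noteq> 0"
      "\<And>i. i \<in> E \<Longrightarrow> (\<Sum>j\<in>J - {p}. M' i j * x j) = 0"
      using insert.IH[of "J - {p}" M'] insert.prems by auto
    define s where "s = (\<Sum>j\<in>J - {p}. M e j * x j)"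
    define x' where "x' = x(p := - (inverse (M e p) * s))"
    have split: "(\<Sum>j\<in>J. M i j * x' j) = M i p * x' p + (\<Sum>j\<in>J - {p}. M i j * x j)" for i
    proof -
      have "(\<Sum>j\<in>J - {p}. M i j * x' j) = (\<Sum>j\<in>J - {p}. M i j * x j)"
        by (rule sum.cong) (auto simp: x'_def)
      then show ?thesis using insert.prems p by (simp add: sum.remove)
    qed
    have "(\<Sum>j\<in>J. M e j * x' j) = 0"
      unfolding split using p(2) by (simp add: x'_def s_def[symmetric] mult.assoc[symmetric])
    moreover have "(\<Sum>j\<in>J. M i j * x' j) = 0" if "i \<in> E" for i
    proof -
      have "0 = (\<Sum>j\<in>J - {p}. M i j * x j) - M i p * inverse (M e p) * s"
        using x(2)[OF that]
        by (simp add: M'_def s_def left_diff_distrib sum_subtractf sum_distrib_left mult.assoc)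
      then show ?thesis unfolding split by (simp add: x'_def mult.assoc)
    qed
    moreover have "\<exists>j\<in>J. x' j \<noteq> 0" using x(1) by (auto simp: x'_def)
    ultimately show ?thesis by (intro exI[of _ x']) auto
  qed
qed

text \<open>If \<open>1\<close>, \<open>q\<close>, \<open>q\<^sup>2\<close> were independent, a linear relation between \<open>1\<close>, \<open>q\<close>, \<open>q\<^sup>2\<close>, \<open>y\<close>,
  \<open>y q\<close> would give \<open>y = m l\<^sup>-\<^sup>1\<close> with \<open>m\<close>, \<open>l\<close> polynomials in \<open>q\<close>, so every \<open>y\<close> would commute
  with \<open>q\<close>.\<close>

lemma (in quaternion_division_algebra) quadratic_over_center:
  assumes "q \<notin> range (\<lambda>a. scale a 1)"
  obtains s t where "q * q = scale s q + scale t 1"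
proof -
  have "\<exists>y. q * y \<noteq> y * q"
    using assms center_eq by auto
  then obtain y where y: "q * y \<noteq> y * q" by blast
  have span1: "v \<in> span {1} \<Longrightarrow> v \<in> range (\<lambda>a. scale a 1)" for v
    by (auto simp: span_singleton)
  have comm: "q * v = v * q" if "v \<in> span {1, q, q * q}" for v
    using that
    by (induction rule: span_induct_alt)
      (auto simp: mult_scale_left mult_scale_right algebra_simps)
  have "q * q \<in> span {1, q}"
  proof (rule ccontr)
    assume nq: "q * q \<notin> span {1, q}"
    have 1: "1 \<notin> span {}" by simp
    have 2: "q \<notin> span {1}" using assms span1 by blast
    have 3: "q * q \<notin> span {q, 1}" using nq by (simp add: insert_commute)
    have 4: "y \<notin> span {q * q, q, 1}" using y comm by (auto simp: insert_commute)
    have 5: "y * q \<notin> span {y, q * q, q, 1}"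
    proof
      assume "y * q \<in> span {y, q * q, q, 1}"
      then obtain c where "y * q - scale c y \<in> span {q * q, q, 1}"
        using span_breakdown_eq by blast
      then have "q * (y * q - scale c y) - (y * q - scale c y) * q = 0"
        using comm[of "y * q - scale c y"] by (simp add: insert_commute)
      \<comment> \<open>The commutator with \<open>q\<close> factors, and the second factor is
        nonzero because \<open>q\<close> is not central; so \<open>y\<close> would commute with
        \<open>q\<close>.\<close>
      moreover have "q * (y * q - scale c y) - (y * q - scale c y) * q =
          (q * y - y * q) * (q - scale c 1)"
        by (simp add: right_diff_distrib left_diff_distrib mult_scale_left mult_scale_right mult.assoc
              scale_right_diff_distrib)
      ultimately have "(q * y - y * q) * (q - scale c 1) = 0" by simp
      moreover have "q - scale c 1 \<noteq> 0" using assms by auto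
      ultimately show False using y by auto
    qed
    have ind: "independent {y * q, y, q * q, q, 1}"
      by (intro independent_insertI 1 2 3 4 5 independent_empty)
    have "distinct [y * q, y, q * q, q, 1]"
      using 2 3 4 5 by (auto intro: span_base)
    then have "card {y * q, y, q * q, q, 1} = 5"
      using distinct_card by force
    moreover obtain B where B: "independent B" "UNIV \<subseteq> span B" "card B = 4"
      using basis_exists[of UNIV] dim_eq_4 by metis
    moreover have "finite B" using B(3) by (intro card_ge_0_finite) simp
    ultimately show False
      using independent_span_bound[of B, OF _ ind] by fastforce
  qed
  then obtain s where "q * q - scale s q \<in> span {1}"
    using span_breakdown_eq[of "q * q" q "{1}"] by (auto simp: insert_commute)
  then obtain t where "q * q - scale s q = scale t 1"
    using span1 by blast
  then show thesis using that by (metis add.commute diff_add_cancel)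
qed

section \<open>Right vector spaces over a division ring\<close>

text \<open>Scalars act on the right, so that left multiplication by a matrix, or by
  \<open>q\<close>, is linear over a noncommutative ring.\<close>

locale right_space =
  fixes act :: "'v::ab_group_add \<Rightarrow> 'q::division_ring \<Rightarrow> 'v" (infixl "\<star>" 75)
  assumes act_add_left: "(u + v) \<star> c = u \<star> c + v \<star> c"
    and act_add_right: "v \<star> (b + c) = v \<star> b + v \<star> c"
    and act_act: "v \<star> b \<star> c = v \<star> (b * c)"
    and act_one [simp]: "v \<star> 1 = v"
begin

lemma act_zero_left [simp]: "0 \<star> c = 0"
  using act_add_left[of 0 0 c] by simp

lemma act_zero_right [simp]: "v \<star> 0 = 0"
  using act_add_right[of v 0 0] by simp

lemma act_minus_left: "(- v) \<star> c = - (v \<star> c)"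
  using act_add_left[of v "- v" c] by (simp add: eq_neg_iff_add_eq_0 add.commute)

lemma act_minus_right: "v \<star> (- c) = - (v \<star> c)"
  using act_add_right[of v c "- c"] by (simp add: eq_neg_iff_add_eq_0 add.commute)

lemma act_diff_left: "(u - v) \<star> c = u \<star> c - v \<star> c"
  using act_add_left[of u "- v" c] by (simp add: act_minus_left)

lemma act_diff_right: "v \<star> (b - c) = v \<star> b - v \<star> c"
  using act_add_right[of v b "- c"] by (simp add: act_minus_right)

lemmas act_simps = act_add_left act_add_right act_minus_left act_minus_right
  act_diff_left act_diff_right act_act

lemma act_eq_0_iff [simp]: "v \<star> c = 0 \<longleftrightarrow> v = 0 \<or> c = 0"
proof
  assume "v \<star> c = 0"
  then have "v \<star> (c * inverse c) = 0" by (metis act_act act_zero_left)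
  then show "v = 0 \<or> c = 0" by (cases "c = 0") auto
qed auto

definition linear_map :: "('v \<Rightarrow> 'v) \<Rightarrow> bool" where
  "linear_map f \<longleftrightarrow> (\<forall>u v. f (u + v) = f u + f v) \<and> (\<forall>v c. f (v \<star> c) = f v \<star> c)"

lemma linear_mapD:
  assumes "linear_map f"
  shows "f (u + v) = f u + f v" "f (v \<star> c) = f v \<star> c" "f 0 = 0" "f (- v) = - f v"
    "f (u - v) = f u - f v"
proof -
  show add: "f (u + v) = f u + f v" for u v using assms by (simp add: linear_map_def)
  show act: "f (v \<star> c) = f v \<star> c" for v c using assms by (simp add: linear_map_def)
  show "f 0 = 0" using act[of 0 0] by simp
  show minus: "f (- v) = - f v" for v using act[of v "-1"] by (simp add: act_minus_right)
  show "f (u - v) = f u - f v" using add[of u "- v"] minus by simp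
qed

lemma linear_map_add:
  "linear_map f \<Longrightarrow> linear_map g \<Longrightarrow> linear_map (\<lambda>v. f v + g v)"
  by (auto simp: linear_map_def act_simps algebra_simps)

end

section \<open>Nilpotent maps in dimension three\<close>

text \<open>Dimension three without choosing a basis: \<open>dependent_4\<close> bounds it from
  above, \<open>not_spanned_by_2\<close> from below.\<close>

locale right_space_3 = right_space act
  for act :: "'v::ab_group_add \<Rightarrow> 'q::division_ring \<Rightarrow> 'v" (infixl "\<star>" 75) +
  assumes dependent_4: "\<And>u v w z. \<exists>a b c e. (a \<noteq> 0 \<or> b \<noteq> 0 \<or> c \<noteq> 0 \<or> e \<noteq> 0) \<and>
      u \<star> a + v \<star> b + w \<star> c + z \<star> e = 0"
    and not_spanned_by_2: "\<And>u v. \<exists>z. \<forall>a b. z \<noteq> u \<star> a + v \<star> b"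
begin

lemma spanned_by_independent_3:
  assumes "\<And>a b c. u \<star> a + v \<star> b + w \<star> c = 0 \<Longrightarrow> a = 0 \<and> b = 0 \<and> c = 0"
  obtains a b c where "z = u \<star> a + v \<star> b + w \<star> c"
proof -
  obtain a b c e where ne: "a \<noteq> 0 \<or> b \<noteq> 0 \<or> c \<noteq> 0 \<or> e \<noteq> 0"
    and eq: "u \<star> a + v \<star> b + w \<star> c + z \<star> e = 0"
    using dependent_4 by meson
  have "e \<noteq> 0" using ne eq assms by auto
  have "z = z \<star> e \<star> inverse e" using \<open>e \<noteq> 0\<close> by (simp add: act_act)
  also have "z \<star> e = - (u \<star> a + v \<star> b + w \<star> c)"
    using eq by (metis add.commute eq_neg_iff_add_eq_0)
  finally have "z = u \<star> (- a * inverse e) + v \<star> (- b * inverse e) + w \<star> (- c * inverse e)"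
    by (simp add: act_simps algebra_simps)
  then show thesis by (rule that)
qed

text \<open>Otherwise the least power of \<open>f\<close> killing \<open>v\<close> is at least the
  fourth. The last four nonzero iterates of \<open>v\<close> are then independent: applying the cube
  of \<open>f\<close>, its square and \<open>f\<close> itself to a relation isolates the
  coefficients one by one. This contradicts \<open>dependent_4\<close>.\<close>

lemma nilpotent_cube:
  assumes f: "linear_map f" and nil: "(f ^^ k) v = 0"
  shows "f (f (f v)) = 0"
proof (rule ccontr)
  assume n3: "f (f (f v)) \<noteq> 0"
  note [simp] = linear_mapD[OF f]
  define m where "m = (LEAST k. (f ^^ k) v = 0)"
  have m0: "(f ^^ m) v = 0" unfolding m_def using nil by (rule LeastI)
  have least: "(f ^^ j) v \<noteq> 0" if "j < m" for j
    using not_less_Least that unfolding m_def by blast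
  have "m \<ge> 4"
  proof (rule ccontr)
    assume "\<not> m \<ge> 4"
    then have "m = 0 \<or> m = 1 \<or> m = 2 \<or> m = 3" by auto
    with m0 n3 show False by (auto simp: numeral_eq_Suc)
  qed
  then obtain i where "m = 4 + i" using le_Suc_ex by blast
  then have i: "m = Suc (Suc (Suc (Suc i)))" by simp
  define w where "w = (f ^^ i) v"
  have w4: "f (f (f (f w))) = 0" using m0 by (simp add: i w_def)
  have w3: "f (f (f w)) \<noteq> 0" using least[of "Suc (Suc (Suc i))"] by (simp add: i w_def)
  obtain a b c e where ne: "a \<noteq> 0 \<or> b \<noteq> 0 \<or> c \<noteq> 0 \<or> e \<noteq> 0"
    and eq: "w \<star> a + f w \<star> b + f (f w) \<star> c + f (f (f w)) \<star> e = 0"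
    using dependent_4 by meson
  have "f (f (f (w \<star> a + f w \<star> b + f (f w) \<star> c + f (f (f w)) \<star> e))) = 0" by (simp add: eq)
  then have a: "a = 0" using w3 w4 by simp
  have "f (f (w \<star> a + f w \<star> b + f (f w) \<star> c + f (f (f w)) \<star> e)) = 0" by (simp add: eq)
  then have b: "b = 0" using w3 w4 a by simp
  have "f (w \<star> a + f w \<star> b + f (f w) \<star> c + f (f (f w)) \<star> e) = 0" by (simp add: eq)
  then have c: "c = 0" using w3 w4 a b by simp
  then show False using eq ne w3 a b by simp
qed

lemma cube_zero_kernel:
  assumes "\<And>v. f (f (f v)) = 0" "linear_map f"
  obtains x where "x \<noteq> 0" "f x = 0"
proof -
  obtain z :: 'v where "z \<noteq> 0" using not_spanned_by_2[of 0 0] by auto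
  then show thesis using that assms(1)[of z] by metis
qed

text \<open>Were the kernel of \<open>f\<close> a plane \<open>P\<close>, then \<open>P\<close> would meet \<open>d\<^sup>-\<^sup>1 P\<close> nontrivially for
  \<open>d = f + g\<close>, giving a \<open>d\<close>-stable subspace on which \<open>g\<close> agrees with the injective map \<open>d\<close>.\<close>

lemma kernel_is_line:
  assumes f: "linear_map f" and g: "linear_map g" and g3: "\<And>v. g (g (g v)) = 0"
    and d: "\<And>v. d v = f v + g v"
    and quad: "\<And>v. d (d v) = d v \<star> s + v \<star> t"
    and inj: "\<And>v. d v = 0 \<Longrightarrow> v = 0"
    and x: "x \<noteq> 0" "f x = 0" and y: "f y = 0"
  shows "\<exists>c. y = x \<star> c"
proof (rule ccontr)
  assume ny: "\<nexists>c. y = x \<star> c"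
  have dlin: "linear_map d" using linear_map_add[OF f g] d by presburger
  note [simp] = linear_mapD[OF f] linear_mapD[OF g]
  note dl = linear_mapD[OF dlin]
  have ind: "a = 0 \<and> b = 0" if "x \<star> a + y \<star> b = 0" for a b
  proof -
    have "b = 0"
    proof (rule ccontr)
      assume "b \<noteq> 0"
      have "y = y \<star> b \<star> inverse b" using \<open>b \<noteq> 0\<close> by (simp add: act_act)
      also have "y \<star> b = - (x \<star> a)" using that by (simp add: eq_neg_iff_add_eq_0 add.commute)
      finally show False using ny by (metis act_act act_minus_left act_minus_right)
    qed
    then show ?thesis using that x by simp
  qed
  obtain a b c e where ne: "a \<noteq> 0 \<or> b \<noteq> 0 \<or> c \<noteq> 0 \<or> e \<noteq> 0"
    and eq: "x \<star> a + y \<star> b + d x \<star> c + d y \<star> e = 0"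
    using dependent_4 by meson
  define u where "u = x \<star> c + y \<star> e"
  have "u \<noteq> 0"
  proof
    assume "u = 0"
    then have "c = 0 \<and> e = 0" using ind by (simp add: u_def)
    then show False using ne eq ind by auto
  qed
  have fu: "f u = 0" using x y by (simp add: u_def)
  have "(x \<star> a + y \<star> b) + d u = 0" using eq by (simp add: u_def dl add_ac)
  then have "d u = - (x \<star> a + y \<star> b)" by (metis add.commute eq_neg_iff_add_eq_0)
  then have fdu: "f (d u) = 0" using x y by simp
  have "g u = d u" "g (d u) = d (d u)" using d[of u] d[of "d u"] fu fdu by simp_all
  \<comment> \<open>By \<open>quad\<close>, \<open>d (d u)\<close> is a combination of
    \<open>d u\<close> and \<open>u\<close>, so it lies in the kernel of \<open>f\<close> as
    well.\<close>
  moreover have "g (d (d u)) = d (d (d u))"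
    using d[of "d (d u)"] quad[of u] fu fdu by simp
  ultimately have "d (d (d u)) = 0" using g3[of u] by simp
  then show False using inj \<open>u \<noteq> 0\<close> by blast
qed

text \<open>Here \<open>d\<close> stands for left multiplication by a noncentral \<open>q\<close>:
  \<open>quad\<close> is the quadratic equation of \<open>q\<close>, and
  \<open>no_eigenvector\<close> expresses noncentrality, since a central eigenvalue would be
  \<open>q\<close> itself.\<close>

lemma not_sum_of_two_nilpotents:
  assumes f: "linear_map f" and g: "linear_map g"
    and f3: "\<And>v. f (f (f v)) = 0" and g3: "\<And>v. g (g (g v)) = 0"
    and d: "\<And>v. d v = f v + g v"
    and quad: "\<And>v. d (d v) = d v \<star> s + v \<star> t"
    and central: "\<And>z. s * z = z * s" "\<And>z. t * z = z * t"
    and no_eigenvector: "\<And>c v. (\<And>z. c * z = z * c) \<Longrightarrow> d v = v \<star> c \<Longrightarrow> v = 0"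
  shows False
proof -
  have dlin: "linear_map d" using linear_map_add[OF f g] d by presburger
  note [simp] = linear_mapD[OF f] linear_mapD[OF g] linear_mapD[OF dlin]
  have inj: "v = 0" if "d v = 0" for v
    using no_eigenvector[of 0 v] that by simp
  obtain x where x: "x \<noteq> 0" "f x = 0" using cube_zero_kernel f3 f by blast
  have gx: "g x = d x" using d[of x] x by simp
  have kerf: "\<exists>c. z = x \<star> c" if "f z = 0" for z
    using kernel_is_line[OF f g g3 d quad inj x that] .
  have t: "t \<noteq> 0"
  proof
    assume "t = 0"
    \<comment> \<open>With \<open>t = 0\<close> the quadratic factors as \<open>q (q - s)\<close>,
      which makes \<open>x\<close> an eigenvector with central eigenvalue \<open>s\<close>.\<close>
    then have "d (d x - x \<star> s) = 0" using quad[of x] by simp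
    then have "d x - x \<star> s = 0" by (rule inj)
    then show False using no_eigenvector[of s x] central x by simp
  qed
  have xdx: "a = 0 \<and> b = 0" if *: "x \<star> a + d x \<star> b = 0" and gd: "g (d x) = 0" for a b
  proof -
    have "g (x \<star> a + d x \<star> b) = 0" using * by simp
    then have "d x \<star> a = 0" using gx gd by simp
    then have "a = 0" using inj x by auto
    then show ?thesis using * inj x by auto
  qed
  show False
  proof (cases "g (d x) = 0")
    case True
    define y where "y = d x"
    have gy: "g y = 0" and gxy: "g x = y" and y0: "y \<noteq> 0"
      using True gx inj x by (auto simp: y_def)
    have fy: "f y = y \<star> s + x \<star> t" using d[of y] quad[of x] gy by (simp add: y_def)
    \<comment> \<open>Since \<open>f x = 0\<close>, \<open>f\<close> multiplies \<open>f y\<close>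
      by \<open>s\<close> on the right.\<close>
    have "f (f (f y)) = f y \<star> (s * s)" by (simp add: fy x act_simps)
    moreover have "f y \<noteq> 0" using d[of y] gy inj y0 by auto
    ultimately have s0: "s = 0" using f3[of y] by simp
    have fy: "f y = x \<star> t" using fy s0 by simp
    obtain z where z: "\<And>a b. z \<noteq> x \<star> a + y \<star> b" using not_spanned_by_2 by metis
    have ind: "a = 0 \<and> b = 0 \<and> c = 0" if *: "x \<star> a + y \<star> b + z \<star> c = 0" for a b c
    proof -
      have "c = 0"
      proof (rule ccontr)
        assume "c \<noteq> 0"
        have "z = z \<star> c \<star> inverse c" using \<open>c \<noteq> 0\<close> by (simp add: act_act)
        also have "z \<star> c = - (x \<star> a + y \<star> b)"
          using * by (metis add.commute eq_neg_iff_add_eq_0)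
        finally have "z = x \<star> (- a * inverse c) + y \<star> (- b * inverse c)"
          by (simp add: act_simps algebra_simps)
        then show False using z by blast
      qed
      then show ?thesis using * xdx True by (simp add: y_def)
    qed
    \<comment> \<open>The map \<open>h\<close> preserves the plane of \<open>x\<close> and
      \<open>y\<close>. On the quotient line, spanned by the class of \<open>z\<close>, it acts by a
      scalar \<open>c\<close>, whose cube must vanish.\<close>
    have quotient: "\<exists>a b. h z = x \<star> a + y \<star> b"
      if h: "linear_map h" "\<And>v. h (h (h v)) = 0" and hx: "h x = y \<star> p" and hy: "h y = x \<star> r"
      for h p r
    proof -
      note [simp] = linear_mapD[OF h(1)]
      obtain a b c where hz: "h z = x \<star> a + y \<star> b + z \<star> c"
        using spanned_by_independent_3[OF ind] by blast
      have "\<exists>a b. h (h (h z)) = x \<star> a + y \<star> b + z \<star> (c * (c * c))"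
      proof -
        have "h (h z) = x \<star> (r * b + a * c) + y \<star> (p * a + b * c) + z \<star> (c * c)"
          by (simp add: hz hx hy act_simps algebra_simps)
        then have "h (h (h z)) = x \<star> (r * (p * a + b * c) + a * (c * c)) +
          y \<star> (p * (r * b + a * c) + b * (c * c)) + z \<star> (c * (c * c))"
          by (simp add: hz hx hy act_simps algebra_simps)
        then show ?thesis by blast
      qed
      then have "c * (c * c) = 0" using h(2)[of z] ind by metis
      then show ?thesis using hz by auto
    qed
    obtain a b where fz: "f z = x \<star> a + y \<star> b"
      using quotient[OF f f3, of 0 t] fy x by auto
    obtain a' b' where gz: "g z = x \<star> a' + y \<star> b'"
      using quotient[OF g g3, of 1 0] gy gxy by auto
    define A B where "A = a + a'" "B = b + b'"
    have dz: "d z = x \<star> A + y \<star> B" using d[of z] fz gz by (simp add: A_B_def act_simps algebra_simps)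
    have "d y = x \<star> t" using quad[of x] s0 by (simp add: y_def)
    \<comment> \<open>As \<open>d x = y\<close> and \<open>d y = x \<star> t\<close> with
      \<open>t \<noteq> 0\<close>, the vector \<open>d z\<close> has a preimage in the plane;
      injectivity of \<open>d\<close> then puts \<open>z\<close> itself there.\<close>
    then have "d (z - x \<star> B - y \<star> (inverse t * A)) = 0"
      using dz t by (simp add: y_def[symmetric] act_simps mult.assoc[symmetric])
    then have "z - x \<star> B - y \<star> (inverse t * A) = 0" by (rule inj)
    then show False using z[of B "inverse t * A"] by (simp add: algebra_simps)
  next
    case False
    \<comment> \<open>Now \<open>g\<close> sends \<open>x\<close> to \<open>w\<close>,
      \<open>w\<close> to \<open>y\<close> and \<open>y\<close> to \<open>0\<close>, with
      \<open>y\<close> nonzero, so these three vectors form a basis.\<close>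
    define w where "w = d x"
    define y where "y = g w"
    have y0: "y \<noteq> 0" using False by (simp add: y_def w_def)
    have gy: "g y = 0" using g3[of x] gx by (simp add: y_def w_def)
    have gw: "g w = y" by (simp add: y_def)
    have gxw: "g x = w" and dx: "d x = w" by (simp_all add: gx w_def)
    have fyd: "f y = d y" using d[of y] gy by simp
    have dw: "d w = w \<star> s + x \<star> t" using quad[of x] by (simp add: w_def)
    have fw: "f w = w \<star> s + x \<star> t - y" using d[of w] dw gw by (simp add: algebra_simps)
    have ind: "a = 0 \<and> b = 0 \<and> c = 0" if *: "x \<star> a + w \<star> b + y \<star> c = 0" for a b c
    proof -
      have "g (g (x \<star> a + w \<star> b + y \<star> c)) = 0" using * by simp
      then have a: "a = 0" using gxw gw gy y0 by simp
      have "g (x \<star> a + w \<star> b + y \<star> c) = 0" using * by simp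
      then have b: "b = 0" using a gxw gw gy y0 by simp
      show ?thesis using * a b y0 by simp
    qed
    obtain a b c where dy: "d y = x \<star> a + w \<star> b + y \<star> c"
      using spanned_by_independent_3[OF ind] by blast
    \<comment> \<open>The kernel of \<open>f\<close> is the line of \<open>x\<close>, so the
      \<open>w\<close> and \<open>y\<close> coordinates of \<open>f (f y)\<close> vanish. This gives
      two equations for \<open>b\<close> and \<open>c\<close>.\<close>
    obtain r where "f (f y) = x \<star> r" using kerf[of "f (f y)"] f3 by blast
    then have "f (d y) = x \<star> r" using fyd by simp
    then have "x \<star> (t * b + a * c - r) + w \<star> (s * b + b * c) + y \<star> (c * c - b) = 0"
      using dy fyd by (simp add: fw x act_simps algebra_simps)
    then have b: "b = c * c" and sb: "s * b + b * c = 0" using ind by force+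
    have dd: "x \<star> (t * b + a * c - a * s) + w \<star> (a + s * b + b * c - b * s) + y \<star> (c * c - c * s - t) = 0"
      using quad[of y] by (simp add: dy dx dw act_simps algebra_simps)
    then have t_eq: "c * c - c * s - t = 0" using ind by blast
    have "c \<noteq> 0" using t_eq t by auto
    have "(s + c) * (c * c) = 0" using sb by (simp add: b algebra_simps)
    then have "s + c = 0" using \<open>c \<noteq> 0\<close> by simp
    then have c: "c = - s" by (simp add: eq_neg_iff_add_eq_0 add.commute)
    have t2: "t = s * s + s * s" using t_eq c by (simp add: algebra_simps)
    \<comment> \<open>The equation of \<open>q\<close> now factors as
      \<open>(q - 2 s) (q + s) = 0\<close>. The vector \<open>w + x \<star> s\<close> is
      \<open>q + s\<close> applied to \<open>x\<close>, so it is zero or an eigenvector for the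
      central value \<open>2 s\<close>; if it is zero, \<open>x\<close> is an eigenvector for
      \<open>- s\<close>.\<close>
    have "d (w + x \<star> s) = (w + x \<star> s) \<star> (s + s)"
      by (simp add: dw dx t2 act_simps algebra_simps)
    then have "w + x \<star> s = 0"
      by (rule no_eigenvector[rotated]) (simp add: central(1) algebra_simps)
    then have "d x = x \<star> (- s)" by (simp add: dx act_simps eq_neg_iff_add_eq_0)
    then show False using no_eigenvector[of "- s" x] central(1) x by simp
  qed
qed

end

section \<open>Triples as column vectors, and the action of 3 by 3 matrices\<close>

text \<open>Triples serve as column vectors because they form a whole type that is an abelian group,
  as \<open>right_space\<close> requires.\<close>

definition act3 :: "'q::division_ring \<times> 'q \<times> 'q \<Rightarrow> 'q \<Rightarrow> 'q \<times> 'q \<times> 'q" where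
  "act3 v c = (fst v * c, fst (snd v) * c, snd (snd v) * c)"

definition mat_apply3 :: "'q::division_ring mat \<Rightarrow> 'q \<times> 'q \<times> 'q \<Rightarrow> 'q \<times> 'q \<times> 'q" where
  "mat_apply3 A v =
    (let c = (\<lambda>i. A $$ (i, 0) * fst v + A $$ (i, 1) * fst (snd v) + A $$ (i, 2) * snd (snd v))
     in (c 0, c 1, c 2))"

interpretation triple: right_space_3 act3
proof
  fix u v w z :: "'q::division_ring \<times> 'q \<times> 'q" and b c :: 'q
  show "act3 (u + v) c = act3 u c + act3 v c" "act3 v (b + c) = act3 v b + act3 v c"
    "act3 (act3 v b) c = act3 v (b * c)" "act3 v 1 = v"
    by (simp_all add: act3_def algebra_simps)
  \<comment> \<open>The columns of \<open>M\<close> are \<open>u\<close>, \<open>v\<close>,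
    \<open>w\<close>, \<open>z\<close>: three equations in four unknowns.\<close>
  define M where "M i j = (let t = [u, v, w, z] ! j in [fst t, fst (snd t), snd (snd t)] ! i)"
    for i j :: nat
  obtain x where "\<exists>j\<in>{0,1,2,3}. x j \<noteq> 0"
    and "\<forall>i\<in>{0,1,2}. (\<Sum>j\<in>{0,1,2,3}. M i j * x j) = 0"
    using homogeneous_system_nontrivial_solution[of "{0,1,2::nat}" "{0,1,2,3::nat}" M] by auto
  then have "(x 0 \<noteq> 0 \<or> x 1 \<noteq> 0 \<or> x 2 \<noteq> 0 \<or> x 3 \<noteq> 0) \<and>
      act3 u (x 0) + act3 v (x 1) + act3 w (x 2) + act3 z (x 3) = 0"
    by (simp add: M_def act3_def zero_prod_def add.assoc)
  then show "\<exists>a b c e. (a \<noteq> 0 \<or> b \<noteq> 0 \<or> c \<noteq> 0 \<or> e \<noteq> 0) \<and>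
      act3 u a + act3 v b + act3 w c + act3 z e = 0" by blast
  show "\<exists>z. \<forall>a b. z \<noteq> act3 u a + act3 v b"
  proof (rule ccontr)
    assume "\<not> ?thesis"
    then have "\<exists>a b. z = act3 u a + act3 v b" for z by blast
    then obtain a b where ab: "\<And>z. z = act3 u (a z) + act3 v (b z)" by metis
    define e :: "nat \<Rightarrow> 'q \<times> 'q \<times> 'q" where "e j = [(1,0,0), (0,1,0), (0,0,1)] ! j" for j
    \<comment> \<open>Column \<open>j\<close> holds the coefficients of the standard basis vector
      \<open>e j\<close> in terms of \<open>u\<close> and \<open>v\<close>. Two equations in three
      unknowns would make the standard basis dependent.\<close>
    define M where "M i j = [a (e j), b (e j)] ! i" for i j :: nat
    obtain x where ne: "\<exists>j\<in>{0,1,2}. x j \<noteq> 0"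
      and eq: "\<forall>i\<in>{0,1}. (\<Sum>j\<in>{0,1,2}. M i j * x j) = 0"
      using homogeneous_system_nontrivial_solution[of "{0,1::nat}" "{0,1,2::nat}" M] by auto
    have "a (e 0) * x 0 + a (e 1) * x 1 + a (e 2) * x 2 = 0"
      "b (e 0) * x 0 + b (e 1) * x 1 + b (e 2) * x 2 = 0"
      using eq by (simp_all add: M_def add.assoc)
    then have "act3 u (a (e 0) * x 0 + a (e 1) * x 1 + a (e 2) * x 2) +
        act3 v (b (e 0) * x 0 + b (e 1) * x 1 + b (e 2) * x 2) = 0"
      by (simp add: act3_def zero_prod_def)
    then have "act3 (act3 u (a (e 0)) + act3 v (b (e 0))) (x 0) +
        act3 (act3 u (a (e 1)) + act3 v (b (e 1))) (x 1) +
        act3 (act3 u (a (e 2)) + act3 v (b (e 2))) (x 2) = 0"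
      by (simp add: act3_def algebra_simps)
    then have "act3 (e 0) (x 0) + act3 (e 1) (x 1) + act3 (e 2) (x 2) = 0"
      by (simp only: ab[symmetric])
    then have "x 0 = 0 \<and> x 1 = 0 \<and> x 2 = 0"
      by (simp add: e_def act3_def zero_prod_def)
    then show False using ne by simp
  qed
qed

lemma linear_map_mat_apply3: "triple.linear_map (mat_apply3 A)"
  by (simp add: triple.linear_map_def mat_apply3_def act3_def Let_def algebra_simps)

lemma mat_apply3_mult:
  assumes "A \<in> carrier_mat 3 3" "B \<in> carrier_mat 3 3"
  shows "mat_apply3 (A * B) v = mat_apply3 A (mat_apply3 B v)"
proof -
  have "(A * B) $$ (i, j) = A $$ (i, 0) * B $$ (0, j) + A $$ (i, 1) * B $$ (1, j) + A $$ (i, 2) * B $$ (2, j)"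
    if "i < 3" "j < 3" for i j
    using assms that by (simp add: scalar_prod_def numeral_eq_Suc)
  then show ?thesis by (simp add: mat_apply3_def Let_def algebra_simps)
qed

lemma mat_apply3_add:
  assumes "A \<in> carrier_mat 3 3" "B \<in> carrier_mat 3 3"
  shows "mat_apply3 (A + B) v = mat_apply3 A v + mat_apply3 B v"
  using assms by (simp add: mat_apply3_def Let_def algebra_simps)

lemma mat_apply3_diag:
  "mat_apply3 (mat_diag 3 (\<lambda>_. q)) v = (q * fst v, q * fst (snd v), q * snd (snd v))"
  by (simp add: mat_apply3_def mat_diag_def)

lemma mat_apply3_pow:
  assumes "A \<in> carrier_mat 3 3"
  shows "mat_apply3 (A ^\<^sub>m k) v = (mat_apply3 A ^^ k) v"
proof (induction k arbitrary: v)
  case 0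
  then show ?case using assms by (simp add: mat_apply3_def)
next
  case (Suc k)
  have "mat_apply3 (A ^\<^sub>m Suc k) v = (mat_apply3 A ^^ k) (mat_apply3 A v)"
    using assms Suc by (simp add: mat_apply3_mult)
  then show ?case by (simp only: funpow_Suc_right o_apply)
qed

lemma nilpotent_mat_cube:
  assumes "nilpotent_mat 3 A"
  shows "mat_apply3 A (mat_apply3 A (mat_apply3 A v)) = 0"
proof -
  obtain k where k: "A \<in> carrier_mat 3 3" "A ^\<^sub>m k = 0\<^sub>m 3 3"
    using assms by (auto simp: nilpotent_mat_def)
  have "(mat_apply3 A ^^ k) v = 0"
    unfolding mat_apply3_pow[OF k(1), symmetric] k(2) by (simp add: mat_apply3_def zero_prod_def)
  then show ?thesis by (rule triple.nilpotent_cube[OF linear_map_mat_apply3])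
qed

section \<open>Scalar diagonal matrices: central and noncentral \<open>q\<close>\<close>

theorem proposition1p4:
  fixes scale :: "'f::field \<Rightarrow> 'q::division_ring \<Rightarrow> 'q"
    and q :: 'q
  assumes "quaternion_division_algebra scale"
    and "q \<noteq> 0"
  shows "\<not> (\<exists>A B :: 'q mat. nilpotent_mat 3 A \<and> nilpotent_mat 3 B \<and> mat_diag 3 (\<lambda>_. q) = A + B)"
proof
  interpret quaternion_division_algebra scale by fact
  assume "\<exists>A B :: 'q mat. nilpotent_mat 3 A \<and> nilpotent_mat 3 B \<and> mat_diag 3 (\<lambda>_. q) = A + B"
  then obtain A B :: "'q mat" where nil: "nilpotent_mat 3 A" "nilpotent_mat 3 B"
    and AB: "mat_diag 3 (\<lambda>_. q) = A + B" by blast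
  define f g d where "f = mat_apply3 A" and "g = mat_apply3 B"
    and "d = mat_apply3 (mat_diag 3 (\<lambda>_. q))"
  have lin: "triple.linear_map f" "triple.linear_map g"
    by (simp_all add: f_def g_def linear_map_mat_apply3)
  have cube: "f (f (f v)) = 0" "g (g (g v)) = 0" for v
    using nil by (simp_all add: f_def g_def nilpotent_mat_cube)
  have sum: "d v = f v + g v" for v
    unfolding d_def f_def g_def AB
    using nil by (intro mat_apply3_add) (auto simp: nilpotent_mat_def)
  have d: "d v = (q * fst v, q * fst (snd v), q * snd (snd v))" for v
    by (simp add: d_def mat_apply3_diag)
  have scalar_central: "scale a 1 * z = z * scale a 1" for a z
    by (simp add: mult_scale_left mult_scale_right)
  show False
  proof (cases "q \<in> range (\<lambda>a. scale a 1)")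
    case True
    then have q: "q * z = z * q" for z using scalar_central by auto
    obtain x where x: "x \<noteq> 0" "f x = 0"
      using triple.cube_zero_kernel[OF cube(1) lin(1)] .
    \<comment> \<open>As \<open>q\<close> is central, \<open>x\<close> is an eigenvector of
      \<open>g\<close> with nonzero eigenvalue \<open>q\<close>, against nilpotency.\<close>
    have "g x = act3 x q" using sum[of x] x by (simp add: d act3_def q)
    then have "g (g (g x)) = act3 x (q * (q * q))"
      by (simp add: triple.linear_mapD[OF lin(2)] triple.act_act mult.assoc)
    then show False using cube(2)[of x] x \<open>q \<noteq> 0\<close> by simp
  next
    case False
    obtain s t where st: "q * q = scale s q + scale t 1"
      using quadratic_over_center[OF False] .
    have "d (d v) = act3 (d v) (scale s 1) + act3 v (scale t 1)" for v
    proof -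
      have "q * (q * z) = q * z * scale s 1 + z * scale t 1" for z
        by (simp add: mult.assoc[symmetric] st distrib_right mult_scale_left mult_scale_right)
      then show ?thesis by (simp add: d act3_def)
    qed
    moreover have "v = 0" if c: "\<And>z. c * z = z * c" and v: "d v = act3 v c" for c v
    proof (rule ccontr)
      assume "v \<noteq> 0"
      \<comment> \<open>Any nonzero coordinate \<open>z\<close> of \<open>v\<close> satisfies
        \<open>q * z = z * c = c * z\<close>; cancelling \<open>z\<close> gives
        \<open>q = c\<close>.\<close>
      then have "\<exists>z. z \<noteq> 0 \<and> q * z = z * c"
        using v by (cases v) (auto simp: d act3_def zero_prod_def)
      then obtain z where "z \<noteq> 0" "q * z = c * z" using c by metis
      then have "q = c" by simp
      then have "q \<in> {z. \<forall>x. z * x = x * z}" using c by simp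
      then show False using False by (simp only: center_eq)
    qed
    ultimately show False
      using triple.not_sum_of_two_nilpotents[OF lin cube sum] scalar_central by blast
  qed
qed

end
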